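(* Let $\mathfrak g$ be one of the matrix Lie algebras $\mathfrak{gl}(n)$, $\mathfrak{sl}(n)$, $\mathfrak{so}(n)$, $\mathfrak u(n)$, $\mathfrak o(p,q)$, $\mathfrak{sp}(2n)$, let $l_0$ be a matrix in the corresponding ambient matrix space, and let $\mathrm{proj}_{\mathfrak g}(l_0)$ be given by the explicit formula for $\mathfrak g$ listed in the context. Then $\mathrm{proj}_{\mathfrak g}(l_0)$ is the unique minimizer of $g\mapsto\|l_0-g\|_F$ over $g\in\mathfrak g$: for every $g\in\mathfrak g$, $$\|l_0-\mathrm{proj}_{\mathfrak g}(l_0)\|_F\le\|l_0-g\|_F,$$ with equality if and only if $g=\mathrm{proj}_{\mathfrak g}(l_0)$.
   Context: $\langle A,B\rangle=\mathrm{Re}\,\mathrm{tr}(A^\dagger B)$ is the real Frobenius inner product (for complex matrices, the real part of the Hermitian form), and $\|A\|_F=\sqrt{\langle A,A\rangle}$. $\mathbb F$ denotes $\mathbb R$ or $\mathbb C$; $M_n(\mathbb F)$ is the space of $n\times n$ matrices over $\mathbb F$, $n\ge1$; $A^T$ is the transpose and $A^\dagger$ the conjugate transpose. $\eta$ is the diagonal matrix of size $p+q\ge 1$ with $p$ diagonal entries $+1$ and $q$ diagonal entries $-1$. $J=\begin{bmatrix}0&I_n\\-I_n&0\end{bmatrix}$, of size $2n$. The algebras, their ambient matrix spaces, and the maps $\mathrm{proj}_{\mathfrak g}$ are: (1) $\mathfrak{gl}(n)=M_n(\mathbb F)$, ambient $M_n(\mathbb F)$, $\mathrm{proj}(l_0)=l_0$.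 (2) $\mathfrak{sl}(n)=\{A\in M_n(\mathbb F):\mathrm{tr}\,A=0\}$, ambient $M_n(\mathbb F)$, $\mathrm{proj}(l_0)=l_0-\frac{\mathrm{tr}\,l_0}{n}I$. (3) $\mathfrak{so}(n)=\{A\in M_n(\mathbb R):A^T=-A\}$, ambient $M_n(\mathbb R)$, $\mathrm{proj}(l_0)=\frac12(l_0-l_0^T)$. (4) $\mathfrak u(n)=\{A\in M_n(\mathbb C):A^\dagger=-A\}$, ambient $M_n(\mathbb C)$, $\mathrm{proj}(l_0)=\frac12(l_0-l_0^\dagger)$. (5) $\mathfrak o(p,q)=\{A\in M_{p+q}(\mathbb R):A^T\eta+\eta A=0\}$, ambient $M_{p+q}(\mathbb R)$, $\mathrm{proj}(l_0)=\frac12(l_0-\eta l_0^T\eta)$. (6) $\mathfrak{sp}(2n)=\{A\in M_{2n}(\mathbb F):A^TJ+JA=0\}$, ambient $M_{2n}(\mathbb F)$, $\mathrm{proj}(l_0)=\frac12(l_0+J^Tl_0^TJ^T)$. *)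

theory Defs
  imports "HOL-Analysis.Inner_Product" "Jordan_Normal_Form.Schur_Decomposition"
begin

definition mat_trace :: "'a :: comm_monoid_add mat \<Rightarrow> 'a"
  where "mat_trace A = (\<Sum>i<dim_row A. A $$ (i, i))"

text \<open>One polymorphic real part for both scalar fields: it is the identity on the reals and
  \<^const>\<open>Re\<close> on the complex numbers.\<close>

definition real_part :: "'a :: {one, real_inner} \<Rightarrow> real"
  where "real_part x = inner 1 x"

lemma real_part_real [simp]: "real_part (x :: real) = x"
  by (simp add: real_part_def)

lemma real_part_complex [simp]: "real_part (z :: complex) = Re z"
  by (simp add: real_part_def inner_complex_def)

text \<open>\<^const>\<open>mat_adjoint\<close> is the conjugate transpose; over the reals, where conjugation is the
  identity, it is the transpose.\<close>

lemma index_mat_adjoint: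
  assumes "i < dim_col A" "j < dim_row A"
  shows "mat_adjoint A $$ (i, j) = conjugate (A $$ (j, i))"
  using assms by (simp add: mat_adjoint_def mat_of_rows_index)

lemma mat_adjoint_real: "mat_adjoint (A :: real mat) = transpose_mat A"
  by (rule eq_matI) (simp_all add: mat_adjoint_def mat_of_rows_index)

definition frob_inner :: "'a :: {conjugatable_field, real_inner} mat \<Rightarrow> 'a mat \<Rightarrow> real"
  where "frob_inner A B = real_part (mat_trace (mat_adjoint A * B))"

definition frob_norm :: "'a :: {conjugatable_field, real_inner} mat \<Rightarrow> real"
  where "frob_norm A = sqrt (frob_inner A A)"

definition unique_frob_minimizer ::
  "'a :: {conjugatable_field, real_inner} mat set \<Rightarrow> 'a mat \<Rightarrow> 'a mat \<Rightarrow> bool"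
  where "unique_frob_minimizer G l0 P \<longleftrightarrow>
    P \<in> G \<and>
    (\<forall>g\<in>G. frob_norm (l0 - P) \<le> frob_norm (l0 - g) \<and>
      (frob_norm (l0 - P) = frob_norm (l0 - g) \<longleftrightarrow> g = P))"

definition eta_mat :: "nat \<Rightarrow> nat \<Rightarrow> real mat"
  where "eta_mat p q = four_block_mat (1\<^sub>m p) (0\<^sub>m p q) (0\<^sub>m q p) (- 1\<^sub>m q)"

definition J_mat :: "nat \<Rightarrow> 'a :: comm_ring_1 mat"
  where "J_mat n = four_block_mat (0\<^sub>m n n) (1\<^sub>m n) (- 1\<^sub>m n) (0\<^sub>m n n)"

definition gl_alg :: "nat \<Rightarrow> 'a mat set"
  where "gl_alg n = carrier_mat n n"

definition sl_alg :: "nat \<Rightarrow> 'a :: comm_monoid_add mat set"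
  where "sl_alg n = {A \<in> carrier_mat n n. mat_trace A = 0}"

definition so_alg :: "nat \<Rightarrow> real mat set"
  where "so_alg n = {A \<in> carrier_mat n n. transpose_mat A = - A}"

definition u_alg :: "nat \<Rightarrow> complex mat set"
  where "u_alg n = {A \<in> carrier_mat n n. mat_adjoint A = - A}"

definition o_alg :: "nat \<Rightarrow> nat \<Rightarrow> real mat set"
  where "o_alg p q = {A \<in> carrier_mat (p + q) (p + q).
    transpose_mat A * eta_mat p q + eta_mat p q * A = 0\<^sub>m (p + q) (p + q)}"

text \<open>The index of \<open>sp_alg\<close> is half the matrix size: \<open>sp_alg n\<close> is the algebra usually
  written \<open>sp(2n)\<close>.\<close>

definition sp_alg :: "nat \<Rightarrow> 'a :: comm_ring_1 mat set"
  where "sp_alg n = {A \<in> carrier_mat (2 * n) (2 * n).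
    transpose_mat A * J_mat n + J_mat n * A = 0\<^sub>m (2 * n) (2 * n)}"

definition proj_gl :: "'a mat \<Rightarrow> 'a mat"
  where "proj_gl l0 = l0"

definition proj_sl :: "nat \<Rightarrow> 'a :: field mat \<Rightarrow> 'a mat"
  where "proj_sl n l0 = l0 - (mat_trace l0 / of_nat n) \<cdot>\<^sub>m 1\<^sub>m n"

definition proj_so :: "real mat \<Rightarrow> real mat"
  where "proj_so l0 = (1 / 2) \<cdot>\<^sub>m (l0 - transpose_mat l0)"

definition proj_u :: "complex mat \<Rightarrow> complex mat"
  where "proj_u l0 = (1 / 2) \<cdot>\<^sub>m (l0 - mat_adjoint l0)"

definition proj_o :: "nat \<Rightarrow> nat \<Rightarrow> real mat \<Rightarrow> real mat"
  where "proj_o p q l0 = (1 / 2) \<cdot>\<^sub>m (l0 - eta_mat p q * transpose_mat l0 * eta_mat p q)"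

definition proj_sp :: "nat \<Rightarrow> 'a :: field mat \<Rightarrow> 'a mat"
  where "proj_sp n l0 = (1 / 2) \<cdot>\<^sub>m
    (l0 + transpose_mat (J_mat n) * transpose_mat l0 * transpose_mat (J_mat n))"

end

theory Submission
  imports Defs
begin

text \<open>Each of the algebras is, inside its ambient space, the fixed-point set of an additive
  involution \<open>\<sigma>\<close> that preserves the Frobenius norm, and each of the listed projections is the
  average \<open>(l0 + \<sigma> l0) / 2\<close>:

  \<^item> \<open>\<sigma> A = A\<close> for the general linear algebra;
  \<^item> \<open>\<sigma> A = A - (2 tr A / n) I\<close>, the reflection in the subspace of trace-free matrices,
    whose orthogonal complement consists of the scalar matrices;
  \<^item> \<open>\<sigma> A = - A\<^sup>\<dagger>\<close> for the skew-adjoint matrices, which are \<open>so\<close> over the reals and \<open>u\<close> over the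
    complex numbers;
  \<^item> \<open>\<sigma> A = - K\<^sup>T A\<^sup>T K\<close> for the Lie algebra \<open>A\<^sup>T K + K A = 0\<close> of the bilinear form given by
    \<open>K = \<eta>\<close> or \<open>K = J\<close>.

  Let \<open>P = (l0 + \<sigma> l0) / 2\<close>. If \<open>\<sigma> g = g\<close>, then \<open>l0 - g\<close> and \<open>\<sigma> l0 - g = \<sigma> (l0 - g)\<close> have the same norm,
  their half-sum is \<open>P - g\<close> and their half-difference is \<open>l0 - P\<close>. The parallelogram law hence says
  \<open>\<parallel>l0 - g\<parallel>\<^sup>2 = \<parallel>l0 - P\<parallel>\<^sup>2 + \<parallel>P - g\<parallel>\<^sup>2\<close>, from which minimality of \<open>P\<close> and the equality case
  are immediate (\<open>unique_frob_minimizer_involution\<close>). What remains for each algebra is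
  to verify the properties of \<open>\<sigma>\<close>.\<close>

section \<open>The Frobenius norm over the real and complex numbers\<close>

text \<open>This class lets one argument serve both scalar fields: its axiom is the only link
  between conjugation and the real inner product that the proofs use.\<close>

class real_or_complex_field = conjugatable_field + real_inner + real_normed_field +
  assumes inner_one_conjugate_mult: "inner 1 (conjugate x * y) = inner x y"

instance real :: real_or_complex_field
  by standard simp

instance complex :: real_or_complex_field
  by standard (simp add: inner_complex_def)

lemma conjugate_one_field [simp]: "conjugate (1 :: 'a :: conjugatable_field) = 1"
proof -
  have "conjugate (1 :: 'a) * conjugate 1 = conjugate 1 * 1"
    by (simp flip: conjugate_dist_mul)
  then show ?thesis
    by (simp only: mult_cancel_left) simp
qed

lemma norm_conjugate_field [simp]:
  "norm (conjugate x) = norm (x :: 'a :: real_or_complex_field)"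
proof -
  have "inner (conjugate x) (conjugate x) = inner x x"
    by (metis inner_one_conjugate_mult conjugate_id mult.commute)
  then show ?thesis
    by (simp add: norm_eq_sqrt_inner)
qed

lemma mat_adjoint_carrier [simp]: "A \<in> carrier_mat m n \<Longrightarrow> mat_adjoint A \<in> carrier_mat n m"
  by (auto simp: mat_adjoint_def)

lemma mat_adjoint_dim [simp]:
  "dim_row (mat_adjoint A) = dim_col A" "dim_col (mat_adjoint A) = dim_row A"
  by (auto simp: mat_adjoint_def)

lemma mat_adjoint_adjoint [simp]: "mat_adjoint (mat_adjoint A) = A"
  by (rule eq_matI) (auto simp: index_mat_adjoint)

lemma mat_adjoint_add:
  fixes A B :: "'a :: conjugatable_field mat"
  assumes "A \<in> carrier_mat m n" "B \<in> carrier_mat m n"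
  shows "mat_adjoint (A + B) = mat_adjoint A + mat_adjoint B"
  using assms by (intro eq_matI) (auto simp: index_mat_adjoint conjugate_dist_add)

lemma mat_adjoint_uminus:
  fixes A :: "'a :: conjugatable_field mat"
  shows "mat_adjoint (- A) = - mat_adjoint A"
  by (rule eq_matI) (auto simp: index_mat_adjoint conjugate_neg)

lemma mat_adjoint_mult:
  fixes A B :: "'a :: conjugatable_field mat"
  assumes "A \<in> carrier_mat l m" "B \<in> carrier_mat m n"
  shows "mat_adjoint (A * B) = mat_adjoint B * mat_adjoint A"
proof (rule eq_matI)
  fix i j assume "i < dim_row (mat_adjoint B * mat_adjoint A)"
    and "j < dim_col (mat_adjoint B * mat_adjoint A)"
  then have "i < n" "j < l"
    using assms by auto
  then show "mat_adjoint (A * B) $$ (i, j) = (mat_adjoint B * mat_adjoint A) $$ (i, j)"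
    using assms
    by (auto simp: index_mat_adjoint scalar_prod_def sum_conjugate conjugate_dist_mul mult.commute)
qed (use assms in auto)

lemma frob_inner_self:
  fixes A :: "'a :: real_or_complex_field mat"
  shows "frob_inner A A = (\<Sum>i<dim_row A. \<Sum>j<dim_col A. (norm (A $$ (i, j)))\<^sup>2)"
proof -
  have "frob_inner A A = (\<Sum>j<dim_col A. \<Sum>i<dim_row A. (norm (A $$ (i, j)))\<^sup>2)"
    by (simp add: frob_inner_def mat_trace_def real_part_def scalar_prod_def index_mat_adjoint
        inner_sum_right inner_one_conjugate_mult power2_norm_eq_inner lessThan_atLeast0)
  also have "\<dots> = (\<Sum>i<dim_row A. \<Sum>j<dim_col A. (norm (A $$ (i, j)))\<^sup>2)"
    by (rule sum.swap)
  finally show ?thesis .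
qed

lemma frob_norm_power2:
  fixes A :: "'a :: real_or_complex_field mat"
  shows "(frob_norm A)\<^sup>2 = (\<Sum>i<dim_row A. \<Sum>j<dim_col A. (norm (A $$ (i, j)))\<^sup>2)"
  by (simp add: frob_norm_def frob_inner_self sum_nonneg)

lemma frob_norm_nonneg [simp]:
  fixes A :: "'a :: real_or_complex_field mat"
  shows "0 \<le> frob_norm A"
  by (simp add: frob_norm_def frob_inner_self sum_nonneg)

lemma frob_norm_diff_eq_0:
  fixes A B :: "'a :: real_or_complex_field mat"
  assumes A: "A \<in> carrier_mat m n" and B: "B \<in> carrier_mat m n" and "frob_norm (A - B) = 0"
  shows "A = B"
proof (rule eq_matI)
  have "(\<Sum>i<m. \<Sum>j<n. (norm ((A - B) $$ (i, j)))\<^sup>2) = 0"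
    using frob_norm_power2[of "A - B"] assms by simp
  then have "\<forall>i<m. \<forall>j<n. (A - B) $$ (i, j) = 0"
    by (simp add: sum_nonneg_eq_0_iff sum_nonneg)
  then show "A $$ (i, j) = B $$ (i, j)" if "i < dim_row B" "j < dim_col B" for i j
    using that A B by auto
qed (use A B in auto)

lemma frob_norm_smult:
  fixes A :: "'a :: real_or_complex_field mat"
  shows "frob_norm (c \<cdot>\<^sub>m A) = norm c * frob_norm A"
proof (rule power2_eq_imp_eq)
  show "(frob_norm (c \<cdot>\<^sub>m A))\<^sup>2 = (norm c * frob_norm A)\<^sup>2"
    by (simp add: frob_norm_power2 power_mult_distrib norm_mult sum_distrib_left)
qed auto

lemma frob_norm_uminus:
  fixes A :: "'a :: real_or_complex_field mat"
  shows "frob_norm (- A) = frob_norm A"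
  by (rule power2_eq_imp_eq) (simp_all add: frob_norm_power2)

lemma frob_norm_transpose:
  fixes A :: "'a :: real_or_complex_field mat"
  shows "frob_norm (transpose_mat A) = frob_norm A"
proof (rule power2_eq_imp_eq)
  show "(frob_norm (transpose_mat A))\<^sup>2 = (frob_norm A)\<^sup>2"
    by (simp add: frob_norm_power2) (rule sum.swap)
qed auto

lemma frob_norm_adjoint:
  fixes A :: "'a :: real_or_complex_field mat"
  shows "frob_norm (mat_adjoint A) = frob_norm A"
proof (rule power2_eq_imp_eq)
  show "(frob_norm (mat_adjoint A))\<^sup>2 = (frob_norm A)\<^sup>2"
    by (simp add: frob_norm_power2 index_mat_adjoint) (rule sum.swap)
qed auto

lemma frob_norm_unitary_mult_left:
  fixes A Q :: "'a :: real_or_complex_field mat"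
  assumes Q: "Q \<in> carrier_mat m m" and unitary: "mat_adjoint Q * Q = 1\<^sub>m m"
    and A: "A \<in> carrier_mat m n"
  shows "frob_norm (Q * A) = frob_norm A"
proof -
  have "mat_adjoint (Q * A) * (Q * A) = mat_adjoint A * ((mat_adjoint Q * Q) * A)"
    using Q A by (simp add: mat_adjoint_mult[of Q m m A n] assoc_mult_mat[of _ n m _ m _ n]
        assoc_mult_mat[of _ m m _ m _ n])
  also have "\<dots> = mat_adjoint A * A"
    using A unitary by simp
  finally show ?thesis
    by (simp add: frob_norm_def frob_inner_def)
qed

lemma frob_norm_unitary_mult_right:
  fixes A Q :: "'a :: real_or_complex_field mat"
  assumes Q: "Q \<in> carrier_mat n n" and unitary: "mat_adjoint Q * Q = 1\<^sub>m n"
    and A: "A \<in> carrier_mat m n"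
  shows "frob_norm (A * Q) = frob_norm A"
proof -
  have "Q * mat_adjoint Q = 1\<^sub>m n"
    using mat_mult_left_right_inverse[OF _ Q unitary] Q by simp
  then have "frob_norm (mat_adjoint Q * mat_adjoint A) = frob_norm (mat_adjoint A)"
    using Q A by (intro frob_norm_unitary_mult_left) auto
  then show ?thesis
    using frob_norm_adjoint[of "A * Q"] by (simp add: mat_adjoint_mult[OF A Q] frob_norm_adjoint)
qed

lemma frob_norm_parallelogram:
  fixes A B :: "'a :: real_or_complex_field mat"
  assumes "A \<in> carrier_mat m n" "B \<in> carrier_mat m n"
  shows "(frob_norm (A + B))\<^sup>2 + (frob_norm (A - B))\<^sup>2
    = 2 * (frob_norm A)\<^sup>2 + 2 * (frob_norm B)\<^sup>2"
proof -
  have entry: "(norm (x + y))\<^sup>2 + (norm (x - y))\<^sup>2 = 2 * (norm x)\<^sup>2 + 2 * (norm y)\<^sup>2" 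
    for x y :: 'a
    by (simp add: power2_norm_eq_inner algebra_simps)
  have "(frob_norm (A + B))\<^sup>2 + (frob_norm (A - B))\<^sup>2
    = (\<Sum>i<m. \<Sum>j<n. (norm (A $$ (i, j) + B $$ (i, j)))\<^sup>2
        + (norm (A $$ (i, j) - B $$ (i, j)))\<^sup>2)"
    using assms by (simp add: frob_norm_power2 sum.distrib)
  also have "\<dots> = 2 * (frob_norm A)\<^sup>2 + 2 * (frob_norm B)\<^sup>2"
    unfolding entry using assms by (simp add: frob_norm_power2 sum.distrib sum_distrib_left)
  finally show ?thesis .
qed

section \<open>Best approximation in the fixed-point set of an isometric involution\<close>

text \<open>Additivity is all the linearity asked of \<open>\<sigma>\<close>: over the complex numbers the adjoint is only real-linear, and
  the sole scalar that occurs, \<open>1 / 2\<close>, is handled by doubling.\<close>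

theorem unique_frob_minimizer_involution:
  fixes G :: "'a :: real_or_complex_field mat set"
  assumes closed: "\<And>A. A \<in> carrier_mat m n \<Longrightarrow> \<sigma> A \<in> carrier_mat m n"
    and add: "\<And>A B. A \<in> carrier_mat m n \<Longrightarrow> B \<in> carrier_mat m n \<Longrightarrow> \<sigma> (A + B) = \<sigma> A + \<sigma> B"
    and involution: "\<And>A. A \<in> carrier_mat m n \<Longrightarrow> \<sigma> (\<sigma> A) = A"
    and isometry: "\<And>A. A \<in> carrier_mat m n \<Longrightarrow> frob_norm (\<sigma> A) = frob_norm A"
    and fixed: "\<And>A. A \<in> G \<longleftrightarrow> A \<in> carrier_mat m n \<and> \<sigma> A = A"
    and l0: "l0 \<in> carrier_mat m n"
    and P: "P = (1 / 2) \<cdot>\<^sub>m (l0 + \<sigma> l0)"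
  shows "unique_frob_minimizer G l0 P"
proof -
  have \<sigma>l0: "\<sigma> l0 \<in> carrier_mat m n"
    using closed l0 .
  have Pc: "P \<in> carrier_mat m n"
    using l0 \<sigma>l0 by (simp add: P)
  have half_double: "A = B" if "A \<in> carrier_mat m n" "B \<in> carrier_mat m n" "A + A = B + B"
    for A B :: "'a mat"
  proof (rule eq_matI)
    fix i j assume ij: "i < dim_row B" "j < dim_col B"
    have "(A + A) $$ (i, j) = (B + B) $$ (i, j)"
      using that(3) by (rule arg_cong)
    then have "A $$ (i, j) + A $$ (i, j) = B $$ (i, j) + B $$ (i, j)"
      using that(1,2) ij by (subst (asm) (1 2) index_add_mat) auto
    then show "A $$ (i, j) = B $$ (i, j)"
      by (simp flip: mult_2)
  qed (use that in auto)
  have PP: "P + P = l0 + \<sigma> l0"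
    unfolding P using l0 \<sigma>l0 by (intro eq_matI) (auto simp: field_simps)
  have "\<sigma> P + \<sigma> P = \<sigma> l0 + \<sigma> (\<sigma> l0)"
    using add[OF Pc Pc] add[OF l0 \<sigma>l0] by (simp add: PP)
  also have "\<dots> = P + P"
    using l0 \<sigma>l0 by (simp add: involution PP comm_add_mat[of _ m n])
  finally have "\<sigma> P = P"
    by (rule half_double[OF closed[OF Pc] Pc])
  then have PG: "P \<in> G"
    using Pc fixed by simp
  have pythagoras: "(frob_norm (l0 - g))\<^sup>2 = (frob_norm (l0 - P))\<^sup>2 + (frob_norm (P - g))\<^sup>2"
    if "g \<in> G" for g
  proof -
    have g: "g \<in> carrier_mat m n" and \<sigma>g: "\<sigma> g = g"
      using that fixed by auto
    let ?X = "(1 / 2) \<cdot>\<^sub>m (l0 - g)" and ?Y = "(1 / 2) \<cdot>\<^sub>m (\<sigma> l0 - g)"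
    have "\<sigma> (l0 - g) + g = \<sigma> (l0 - g + g)"
      using add[OF minus_carrier_mat[OF g] g] \<sigma>g by simp
    also have "l0 - g + g = l0"
      using l0 g by (intro eq_matI) auto
    finally have "\<sigma> (l0 - g) + g - g = \<sigma> l0 - g"
      by simp
    moreover have "\<sigma> (l0 - g) + g - g = \<sigma> (l0 - g)"
      using g carrier_matD[OF closed[OF minus_carrier_mat[OF g, of l0]]]
      by (intro eq_matI) auto
    ultimately have "\<sigma> (l0 - g) = \<sigma> l0 - g"
      by simp
    then have same: "frob_norm (\<sigma> l0 - g) = frob_norm (l0 - g)"
      using isometry[OF minus_carrier_mat[OF g, of l0]] by simp
    have "?X + ?Y = P - g" "?X - ?Y = l0 - P"
      using l0 \<sigma>l0 g by (auto simp: P field_simps intro!: eq_matI)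
    moreover have "(frob_norm (?X + ?Y))\<^sup>2 + (frob_norm (?X - ?Y))\<^sup>2
        = 2 * (frob_norm ?X)\<^sup>2 + 2 * (frob_norm ?Y)\<^sup>2"
      using l0 \<sigma>l0 g by (intro frob_norm_parallelogram[of _ m n]) auto
    ultimately show ?thesis
      by (simp add: frob_norm_smult same norm_divide power_mult_distrib power_divide)
  qed
  show ?thesis
    unfolding unique_frob_minimizer_def
  proof (intro conjI ballI PG)
    fix g assume g: "g \<in> G"
    show "frob_norm (l0 - P) \<le> frob_norm (l0 - g)"
      by (rule power2_le_imp_le) (simp_all add: pythagoras[OF g])
    show "frob_norm (l0 - P) = frob_norm (l0 - g) \<longleftrightarrow> g = P"
      using pythagoras[OF g] frob_norm_diff_eq_0[OF Pc, of g] g fixed by auto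
  qed
qed

section \<open>The isometric involutions of the classical algebras\<close>

lemma unique_frob_minimizer_gl:
  fixes l0 :: "'a :: real_or_complex_field mat"
  assumes "l0 \<in> carrier_mat n n"
  shows "unique_frob_minimizer (gl_alg n) l0 (proj_gl l0)"
  using assms
  by (intro unique_frob_minimizer_involution[where \<sigma> = "\<lambda>A. A" and m = n and n = n])
    (auto simp: gl_alg_def proj_gl_def field_simps intro!: eq_matI)

lemma mat_trace_diff_scalar:
  fixes A :: "'a :: comm_ring_1 mat"
  assumes "A \<in> carrier_mat n n"
  shows "mat_trace (A - c \<cdot>\<^sub>m 1\<^sub>m n) = mat_trace A - of_nat n * c"
  using assms by (simp add: mat_trace_def sum_subtractf)

text \<open>Subtracting \<open>c I\<close> changes only the diagonal entries, so the squared norm changes by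
  \<open>n \<parallel>c\<parallel>\<^sup>2 - 2 \<langle>tr A, c\<rangle>\<close>, which vanishes for \<open>c = 2 tr A / n\<close>.\<close>

lemma frob_norm_trace_reflection:
  fixes A :: "'a :: real_or_complex_field mat"
  assumes A: "A \<in> carrier_mat n n" and n: "n \<ge> 1"
  shows "frob_norm (A - (2 * mat_trace A / of_nat n) \<cdot>\<^sub>m 1\<^sub>m n) = frob_norm A"
proof (rule power2_eq_imp_eq)
  define t where "t = mat_trace A"
  define c where "c = 2 * t / of_nat n"
  have c: "c = (2 / real n) *\<^sub>R t"
    by (simp add: c_def scaleR_conv_of_real)
  have "(frob_norm (A - c \<cdot>\<^sub>m 1\<^sub>m n))\<^sup>2
      = (\<Sum>i<n. \<Sum>j<n. (norm (A $$ (i, j)))\<^sup>2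
          + (if i = j then (norm c)\<^sup>2 - 2 * inner (A $$ (i, i)) c else 0))"
    unfolding frob_norm_power2 using A
    by (intro sum.cong) (auto simp: power2_norm_eq_inner algebra_simps inner_commute)
  also have "\<dots> = (frob_norm A)\<^sup>2 + (real n * (norm c)\<^sup>2 - 2 * inner t c)"
    using A by (simp add: frob_norm_power2 sum.distrib sum_subtractf t_def mat_trace_def
        inner_sum_left sum_distrib_left)
  also have "real n * (norm c)\<^sup>2 - 2 * inner t c = 0"
    using n by (simp add: c power_mult_distrib field_simps power2_eq_square
        flip: power2_norm_eq_inner)
  finally show "(frob_norm (A - (2 * mat_trace A / of_nat n) \<cdot>\<^sub>m 1\<^sub>m n))\<^sup>2 = (frob_norm A)\<^sup>2"
    by (simp add: c_def t_def)
qed auto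

lemma unique_frob_minimizer_sl:
  fixes l0 :: "'a :: real_or_complex_field mat"
  assumes l0: "l0 \<in> carrier_mat n n" and n: "n \<ge> 1"
  shows "unique_frob_minimizer (sl_alg n) l0 (proj_sl n l0)"
proof -
  let ?\<sigma> = "\<lambda>A :: 'a mat. A - (2 * mat_trace A / of_nat n) \<cdot>\<^sub>m 1\<^sub>m n"
  have n0: "(of_nat n :: 'a) \<noteq> 0"
    using n by simp
  show ?thesis
  proof (rule unique_frob_minimizer_involution[where \<sigma> = ?\<sigma> and m = n and n = n])
    fix A :: "'a mat" assume A: "A \<in> carrier_mat n n"
    show "?\<sigma> A \<in> carrier_mat n n"
      by (intro minus_carrier_mat smult_carrier_mat one_carrier_mat)
    show "frob_norm (?\<sigma> A) = frob_norm A"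
      using A n by (rule frob_norm_trace_reflection)
    have tr: "mat_trace (?\<sigma> A) = - mat_trace A"
      using A n0 by (simp add: mat_trace_diff_scalar)
    show "?\<sigma> (?\<sigma> A) = A"
      unfolding tr using A by (intro eq_matI) auto
    show "?\<sigma> (A + B) = ?\<sigma> A + ?\<sigma> B" if B: "B \<in> carrier_mat n n" for B
    proof -
      have "mat_trace (A + B) = mat_trace A + mat_trace B"
        using A B by (simp add: mat_trace_def sum.distrib)
      then show ?thesis
        using A B by (intro eq_matI) (auto simp: add_divide_distrib algebra_simps)
    qed
  next
    fix A :: "'a mat"
    show "A \<in> sl_alg n \<longleftrightarrow> A \<in> carrier_mat n n \<and> ?\<sigma> A = A"
    proof (cases "A \<in> carrier_mat n n")
      case A: True
      have "mat_trace A = 0" if "?\<sigma> A = A"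
      proof -
        have "(?\<sigma> A) $$ (0, 0) = A $$ (0, 0)"
          using that by simp
        then show ?thesis
          using A n n0 by simp
      qed
      moreover have "?\<sigma> A = A" if "mat_trace A = 0"
        using that A by (intro eq_matI) auto
      ultimately show ?thesis
        using A by (auto simp: sl_alg_def)
    qed (simp add: sl_alg_def)
  next
    show "proj_sl n l0 = (1 / 2) \<cdot>\<^sub>m (l0 + ?\<sigma> l0)"
      using l0 by (intro eq_matI) (auto simp: proj_sl_def field_simps)
  qed (rule l0)
qed

text \<open>Since the adjoint of a real matrix is its transpose, this serves both the orthogonal and
  the unitary algebra.\<close>

lemma unique_frob_minimizer_skew_adjoint:
  fixes l0 :: "'a :: real_or_complex_field mat"
  assumes l0: "l0 \<in> carrier_mat n n"
  shows "unique_frob_minimizer {A \<in> carrier_mat n n. mat_adjoint A = - A} l0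
    ((1 / 2) \<cdot>\<^sub>m (l0 - mat_adjoint l0))"
proof (rule unique_frob_minimizer_involution[where \<sigma> = "\<lambda>A. - mat_adjoint A" and m = n and n = n])
  show "- mat_adjoint (A + B) = - mat_adjoint A + - mat_adjoint B"
    if "A \<in> carrier_mat n n" "B \<in> carrier_mat n n" for A B :: "'a mat"
    using that by (intro eq_matI) (auto simp: mat_adjoint_add)
  show "A \<in> {A \<in> carrier_mat n n. mat_adjoint A = - A}
      \<longleftrightarrow> A \<in> carrier_mat n n \<and> - mat_adjoint A = A" for A :: "'a mat"
  proof -
    have "mat_adjoint A = - A \<longleftrightarrow> - mat_adjoint A = A"
      by (metis uminus_uminus_mat)
    then show ?thesis
      by simp
  qed
  show "(1 / 2) \<cdot>\<^sub>m (l0 - mat_adjoint l0) = (1 / 2) \<cdot>\<^sub>m (l0 + - mat_adjoint l0)"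
    using l0 by (intro eq_matI) auto
qed (auto simp: l0 mat_adjoint_uminus frob_norm_uminus frob_norm_adjoint)

text \<open>Multiplying \<open>A\<^sup>T K + K A = 0\<close> by \<open>K\<^sup>T = K\<^sup>-\<^sup>1\<close> turns the defining equation of the Lie algebra of
  the bilinear form with Gram matrix \<open>K\<close> into \<open>- K\<^sup>T A\<^sup>T K = A\<close>. The left-hand side is an isometry
  of \<open>A\<close> because \<open>K\<close> is orthogonal with entries fixed by conjugation, hence unitary, and its square
  is the identity because the form is symmetric or alternating: \<open>K * K = \<plusminus> K\<^sup>T * K = \<plusminus> I\<close>.\<close>

lemma unique_frob_minimizer_form:
  fixes l0 K :: "'a :: real_or_complex_field mat"
  assumes l0: "l0 \<in> carrier_mat n n" and K: "K \<in> carrier_mat n n"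
    and real_entries: "mat_adjoint K = transpose_mat K"
    and orth: "transpose_mat K * K = 1\<^sub>m n"
    and sym: "transpose_mat K = K \<or> transpose_mat K = - K"
  shows "unique_frob_minimizer
    {A \<in> carrier_mat n n. transpose_mat A * K + K * A = 0\<^sub>m n n} l0
    ((1 / 2) \<cdot>\<^sub>m (l0 - transpose_mat K * transpose_mat l0 * K))"
proof -
  let ?T = transpose_mat
  let ?\<sigma> = "\<lambda>A. - (?T K * ?T A * K)"
  have KT: "?T K \<in> carrier_mat n n"
    using K by simp
  have orth': "K * ?T K = 1\<^sub>m n"
    using mat_mult_left_right_inverse[OF KT K orth] .
  show ?thesis
  proof (rule unique_frob_minimizer_involution[where \<sigma> = ?\<sigma> and m = n and n = n])
    fix A :: "'a mat" assume A: "A \<in> carrier_mat n n"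
    have AT: "?T A \<in> carrier_mat n n"
      using A by simp
    show "?\<sigma> A \<in> carrier_mat n n"
      using A K by simp
    show "?\<sigma> (A + B) = ?\<sigma> A + ?\<sigma> B" if B: "B \<in> carrier_mat n n" for B
    proof -
      have "?T K * ?T (A + B) * K = ?T K * ?T A * K + ?T K * ?T B * K"
        using A B K by (simp add: transpose_add[OF A B] mult_add_distrib_mat[OF KT, of _ n]
            add_mult_distrib_mat[of _ n n _ K n])
      then show ?thesis
        using A B K by (intro eq_matI) auto
    qed
    show "?\<sigma> (?\<sigma> A) = A"
    proof -
      have "?T (?T K * ?T A * K) = ?T K * A * K"
        using A K by (simp add: transpose_mult[of _ n n _ n] assoc_mult_mat[of _ n n _ n _ n])
      then have "?\<sigma> (?\<sigma> A) = ?T K * (?T K * A * K) * K"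
        using A K by (simp add: transpose_uminus)
      also have "\<dots> = ?T K * ?T K * A * (K * K)"
        using A K by (simp add: assoc_mult_mat[of _ n n _ n _ n])
      also have "\<dots> = (?T K * K) * A * (?T K * K)"
        using sym A K by auto
      also have "\<dots> = A"
        using A by (simp add: orth)
      finally show ?thesis .
    qed
    have "frob_norm (?T K * ?T A * K) = frob_norm (?T K * ?T A)"
      using AT K KT by (intro frob_norm_unitary_mult_right[of _ n _ n]) (auto simp: real_entries orth)
    also have "\<dots> = frob_norm (?T A)"
      using AT K orth' by (intro frob_norm_unitary_mult_left[of _ n _ n])
        (auto simp flip: real_entries)
    finally show "frob_norm (?\<sigma> A) = frob_norm A"
      by (simp add: frob_norm_uminus frob_norm_transpose)
  next
    fix A :: "'a mat"
    have "?T A * K + K * A = 0\<^sub>m n n \<longleftrightarrow> ?\<sigma> A = A" if A: "A \<in> carrier_mat n n"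
    proof -
      let ?W = "?T A * K + K * A" and ?X = "?T K * ?T A * K"
      have W: "?W \<in> carrier_mat n n" and X: "?X \<in> carrier_mat n n"
        using A K by auto
      have "?T K * (K * A) = A" "?T K * (?T A * K) = ?X"
        using A K orth assoc_mult_mat[OF KT K A] assoc_mult_mat[OF KT _ K, of "?T A"] by auto
      then have KW: "?T K * ?W = ?X + A"
        using A K by (simp add: mult_add_distrib_mat[OF KT, of _ n])
      have "?W = K * (?T K * ?W)"
        using assoc_mult_mat[OF K KT W] left_mult_one_mat[OF W] orth' by simp
      then have "?W = 0\<^sub>m n n \<longleftrightarrow> ?X + A = 0\<^sub>m n n"
        using K KT KW by (metis right_mult_zero_mat)
      also have "\<dots> \<longleftrightarrow> - ?X = A"
      proof
        show "- ?X = A" if "?X + A = 0\<^sub>m n n"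
        proof (rule eq_matI)
          fix i j assume ij: "i < dim_row A" "j < dim_col A"
          have "(?X + A) $$ (i, j) = 0"
            using that ij A by simp
          then show "(- ?X) $$ (i, j) = A $$ (i, j)"
            using ij A X by (auto simp: add_eq_0_iff2 simp del: index_mult_mat(1))
        qed (use A X in auto)
        show "?X + A = 0\<^sub>m n n" if "- ?X = A"
          using X by (subst that[symmetric]) (intro eq_matI, auto)
      qed
      finally show ?thesis .
    qed
    then show "A \<in> {A \<in> carrier_mat n n. ?T A * K + K * A = 0\<^sub>m n n}
        \<longleftrightarrow> A \<in> carrier_mat n n \<and> ?\<sigma> A = A"
      by blast
  next
    show "(1 / 2) \<cdot>\<^sub>m (l0 - ?T K * ?T l0 * K) = (1 / 2) \<cdot>\<^sub>m (l0 + ?\<sigma> l0)"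
      using l0 K by (intro eq_matI) auto
  qed (rule l0)
qed

lemma uminus_zero_mat: "- 0\<^sub>m m n = (0\<^sub>m m n :: 'a :: group_add mat)"
  by (rule eq_matI) auto

lemma eta_mat_orthogonal:
  "eta_mat p q \<in> carrier_mat (p + q) (p + q)"
  "transpose_mat (eta_mat p q) = eta_mat p q"
  "eta_mat p q * eta_mat p q = 1\<^sub>m (p + q)"
proof -
  show "eta_mat p q \<in> carrier_mat (p + q) (p + q)"
    by (simp add: eta_mat_def)
  show "transpose_mat (eta_mat p q) = eta_mat p q"
    by (rule eq_matI) (auto simp: eta_mat_def)
  show "eta_mat p q * eta_mat p q = 1\<^sub>m (p + q)"
    unfolding eta_mat_def
    by (subst mult_four_block_mat[of _ p p _ q _ q _ _ p _ q]) (auto simp: uminus_zero_mat)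
qed

lemma J_mat_orthogonal:
  "J_mat n \<in> carrier_mat (2 * n) (2 * n)"
  "transpose_mat (J_mat n) = - J_mat n"
  "transpose_mat (J_mat n) * J_mat n = 1\<^sub>m (2 * n)"
proof -
  show "J_mat n \<in> carrier_mat (2 * n) (2 * n)"
    by (simp add: J_mat_def mult_2)
  show "transpose_mat (J_mat n) = - J_mat n"
    by (rule eq_matI) (auto simp: J_mat_def)
  show "transpose_mat (J_mat n) * J_mat n = 1\<^sub>m (2 * n)"
    unfolding J_mat_def
    by (subst transpose_four_block_mat[of _ n n _ n _ n])
      (auto simp: mult_four_block_mat[of _ n n _ n _ n _ _ n _ n] mult_2 transpose_uminus
        uminus_zero_mat)
qed

lemma mat_adjoint_J_mat:
  "mat_adjoint (J_mat n :: 'a :: conjugatable_field mat) = transpose_mat (J_mat n)"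
  by (rule eq_matI) (auto simp: index_mat_adjoint J_mat_def conjugate_neg)

lemma unique_frob_minimizer_o:
  assumes "l0 \<in> carrier_mat (p + q) (p + q)"
  shows "unique_frob_minimizer (o_alg p q) l0 (proj_o p q l0)"
  using unique_frob_minimizer_form[OF assms, of "eta_mat p q"]
  by (simp add: eta_mat_orthogonal mat_adjoint_real o_alg_def proj_o_def)

text \<open>The listed formula \<open>l0 + J\<^sup>T l0\<^sup>T J\<^sup>T\<close> is \<open>l0 - J\<^sup>T l0\<^sup>T J\<close>, as \<open>J\<close> is skew-symmetric.\<close>

lemma unique_frob_minimizer_sp:
  fixes l0 :: "'a :: real_or_complex_field mat"
  assumes l0: "l0 \<in> carrier_mat (2 * n) (2 * n)"
  shows "unique_frob_minimizer (sp_alg n) l0 (proj_sp n l0)"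
proof -
  let ?J = "J_mat n :: 'a mat"
  have J: "?J \<in> carrier_mat (2 * n) (2 * n)" "transpose_mat ?J = - ?J"
      "transpose_mat ?J * ?J = 1\<^sub>m (2 * n)"
    by (rule J_mat_orthogonal)+
  have X: "transpose_mat ?J * transpose_mat l0 \<in> carrier_mat (2 * n) (2 * n)"
    using l0 J(1) by simp
  have "transpose_mat ?J * transpose_mat l0 * transpose_mat ?J
      = - (transpose_mat ?J * transpose_mat l0 * ?J)"
    using X J(1) by (subst (2) J(2)) auto
  then have "l0 + transpose_mat ?J * transpose_mat l0 * transpose_mat ?J
      = l0 - transpose_mat ?J * transpose_mat l0 * ?J"
    using l0 X J(1) by (intro eq_matI) auto
  then show ?thesis
    using unique_frob_minimizer_form[OF l0 J(1) mat_adjoint_J_mat J(3)] J(2)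
    by (simp add: sp_alg_def proj_sp_def)
qed

theorem theorem3:
  fixes n p q :: nat
  assumes "n \<ge> 1" and "p + q \<ge> 1"
  shows
    "(\<forall>l0 :: real mat. l0 \<in> carrier_mat n n \<longrightarrow>
        unique_frob_minimizer (gl_alg n) l0 (proj_gl l0)) \<and>
     (\<forall>l0 :: complex mat. l0 \<in> carrier_mat n n \<longrightarrow>
        unique_frob_minimizer (gl_alg n) l0 (proj_gl l0)) \<and>
     (\<forall>l0 :: real mat. l0 \<in> carrier_mat n n \<longrightarrow>
        unique_frob_minimizer (sl_alg n) l0 (proj_sl n l0)) \<and>
     (\<forall>l0 :: complex mat. l0 \<in> carrier_mat n n \<longrightarrow>
        unique_frob_minimizer (sl_alg n) l0 (proj_sl n l0)) \<and>
     (\<forall>l0 :: real mat. l0 \<in> carrier_mat n n \<longrightarrow>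
        unique_frob_minimizer (so_alg n) l0 (proj_so l0)) \<and>
     (\<forall>l0 :: complex mat. l0 \<in> carrier_mat n n \<longrightarrow>
        unique_frob_minimizer (u_alg n) l0 (proj_u l0)) \<and>
     (\<forall>l0 :: real mat. l0 \<in> carrier_mat (p + q) (p + q) \<longrightarrow>
        unique_frob_minimizer (o_alg p q) l0 (proj_o p q l0)) \<and>
     (\<forall>l0 :: real mat. l0 \<in> carrier_mat (2 * n) (2 * n) \<longrightarrow>
        unique_frob_minimizer (sp_alg n) l0 (proj_sp n l0)) \<and>
     (\<forall>l0 :: complex mat. l0 \<in> carrier_mat (2 * n) (2 * n) \<longrightarrow>
        unique_frob_minimizer (sp_alg n) l0 (proj_sp n l0))"
  using assms unique_frob_minimizer_skew_adjoint[where ?'a = real]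
    unique_frob_minimizer_skew_adjoint[where ?'a = complex]
  by (auto simp: so_alg_def proj_so_def u_alg_def proj_u_def mat_adjoint_real
      intro: unique_frob_minimizer_gl unique_frob_minimizer_sl
        unique_frob_minimizer_o unique_frob_minimizer_sp)

end
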